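(* Let $t_1,t_2$ and $h_i,l_i,\tilde h_i,\tilde l_i,\alpha_i,\tilde\alpha_i$ ($i=1,2$), $\beta,\tilde\beta,\mu_0,\mu,\chi,\nu$ be complex parameters satisfying \begin{gather*} \chi = \big( \tilde{h}_1 + \tilde{h}_2 - \tilde{l}_1 - \tilde{l}_2 + \tilde{\alpha }_1 - \tilde{\alpha }_2 - \tilde{\beta } \big)/2 , \qquad \nu = \mu _0 + \alpha _1 - \tilde{\alpha }_2 ,\qquad \mu = \mu _0 + \chi + 1, \\ \beta = - \tilde{\beta } - \chi , \qquad \alpha _2 = \alpha _1 + \tilde{\alpha }_1 - \tilde{\alpha }_2 - \chi , \\ l_i =\tilde{h}_i + \mu _0 , \qquad h_i = \tilde{l}_i +\mu _0 + \chi , \qquad i=1,2. \end{gather*} Let $P_{\mu,\mu_0}(x,s)$ be a function satisfying \begin{gather*} P_{\mu ,\mu _0} (x,s/q)= P_{\mu ,\mu _0 } (qx,s) = \frac{x-q^{\mu -1 }s}{x-q^{\mu _0 -1} s} P_{\mu ,\mu _0 } (x,s), \\ P_{\mu ,\mu _0 } (x,qs)= P_{\mu ,\mu _0 } (x/q,s) = \frac{x-q^{\mu _0 } s}{x-q^{\mu }s} P_{\mu ,\mu _0 } (x,s) . \end{gather*} Then \begin{gather*} A^{\langle 4 \rangle} ( x; h_1, h_2, l_1, l_2, \alpha _1, \alpha _2, \beta )\, x^{- \alpha _1} s^{1+\chi - \tilde{\alpha }_1} P_{\mu ,\mu _0} (x,s) \\ = q^{\nu } A^{\langle 4 \rangle}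 \big( s; \tilde{h}_1, \tilde{h}_2, \tilde{l}_1, \tilde{l}_2, \tilde{\alpha }_1, \tilde{\alpha }_2, \tilde{\beta } \big)\, x^{- \alpha _1} s^{1+\chi - \tilde{\alpha }_1} P_{\mu ,\mu _0 } (x,s) . \end{gather*}
   Context: $q$ is a complex number with $0<|q|<1$. Complex powers are taken with a fixed branch of $\log q$, so that $q^a=\exp(a\log q)$ and power functions obey $(q^{\pm1}x)^a=q^{\pm a}x^a$. Identities are understood at points where all expressions are defined. $T_x^{\pm1}$ is the $q$-shift operator in $x$, $T_x^{\pm1}g(x)=g(q^{\pm1}x)$, acting on the variable $x$ only (similarly $T_s^{\pm 1}$). With fixed complex parameters $t_1,t_2$ (the same for both operators), the operator $A^{\langle 4\rangle}$ is \begin{gather*} A^{\langle 4 \rangle} ( x; h_1, h_2, l_1, l_2, \alpha _1, \alpha _2, \beta ) = x^{-1} (x-q^{h_1 + 1/2} t_1) (x-q^{h_2 +1/2} t_2) T_{x}^{-1} \\ {}+ q^{\alpha _1 +\alpha _2} x^{-1} (x - q^{l_1 -1/2} t_1) (x - q^{l_2 -1/2} t_2) T_{x}\\ {}-\big\{ (q^{\alpha _1} +q^{\alpha _2} ) x + q^{(h_1 +h_2 + l_1 +l_2 +\alpha _1 +\alpha _2 )/2}( q^{\beta/2} + q^{-\beta/2} ) t_1 t_2 x^{-1} \big\}. \end{gather*} $A^{\langle 4 \rangle}(s;\dots)$ is the same operator with $x$ replaced by $s$ and $T_x$ by $T_s$. *)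

theory Defs
  imports "HOL-Analysis.Analysis"
begin

text \<open>
  The branch of \<open>log q\<close> is passed around as a complex number \<open>L\<close> with \<open>exp L = q\<close>.
\<close>

definition q_power :: "complex \<Rightarrow> complex \<Rightarrow> complex" where
  "q_power L a = exp (a * L)"

text \<open>
  Power functions must obey \<open>(q x)^a = q^a x^a\<close> for the chosen \<open>log q\<close>, which the principal
  branch (\<open>powr\<close>) does not do. We therefore use \<open>x^a = exp (a * l x)\<close> for a branch \<open>l\<close> of the
  logarithm on the nonzero complex numbers with \<open>l (q x) = l x + log q\<close>. No continuity of \<open>l\<close> is
  demanded: a continuous branch of this kind exists only on a slit plane whose slit is invariant
  under \<open>x \<mapsto> q x\<close>, and it extends to all nonzero \<open>x\<close> in the sense below.
\<close>

definition q_log_branch :: "complex \<Rightarrow> complex \<Rightarrow> (complex \<Rightarrow> complex) \<Rightarrow> bool" where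
  "q_log_branch q L l \<longleftrightarrow> (\<forall>x. x \<noteq> 0 \<longrightarrow> exp (l x) = x \<and> l (q * x) = l x + L)"

definition branch_power :: "(complex \<Rightarrow> complex) \<Rightarrow> complex \<Rightarrow> complex \<Rightarrow> complex" where
  "branch_power l x a = exp (a * l x)"

lemma branch_power_shift:
  assumes "q_log_branch q L l" "q \<noteq> 0" "x \<noteq> 0"
  shows "branch_power l (q * x) a = q_power L a * branch_power l x a"
    and "branch_power l (x / q) a = q_power L (- a) * branch_power l x a"
proof -
  show "branch_power l (q * x) a = q_power L a * branch_power l x a"
    using assms by (simp add: q_log_branch_def branch_power_def q_power_def
        distrib_left exp_add)
  have "l (q * (x / q)) = l (x / q) + L"
    using assms unfolding q_log_branch_def by (metis divide_eq_0_iff)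
  then have "l (x / q) = l x - L"
    using assms by simp
  then show "branch_power l (x / q) a = q_power L (- a) * branch_power l x a"
    by (simp add: branch_power_def q_power_def right_diff_distrib exp_diff exp_minus
        divide_inverse mult.commute)
qed

lemma q_log_branch_exists:
  assumes "0 < norm q" "norm q < 1" "exp L = q"
  shows "\<exists>l. q_log_branch q L l"
proof -
  have q: "norm q = exp (Re L)" 
    using assms(3) by (metis norm_exp_eq_Re)
  then have neg: "Re L \<noteq> 0" using assms(2) by auto
  define k :: "complex \<Rightarrow> complex" where "k x = of_int \<lfloor>ln (norm x) / Re L\<rfloor>" for x :: complex
  define l where "l x = Ln (x / exp (k x * L)) + k x * L" for x :: complex
  have "exp (l x) = x \<and> l (q * x) = l x + L" if "x \<noteq> 0" for x
  proof
    show "exp (l x) = x" using that by (simp add: l_def exp_add)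
    have "ln (norm (q * x)) / Re L = ln (norm x) / Re L + 1"
      using that neg q by (simp add: norm_mult ln_mult add_divide_distrib)
    then have k: "k (q * x) = k x + 1" by (simp add: k_def)
    have "q * x / exp (k (q * x) * L) = x / exp (k x * L)"
      using assms by (simp add: k distrib_right exp_add)
    then show "l (q * x) = l x + L"
      unfolding l_def by (simp add: k distrib_right)
  qed
  then show ?thesis by (auto simp: q_log_branch_def)
qed

definition q_shift :: "complex \<Rightarrow> (complex \<Rightarrow> complex) \<Rightarrow> complex \<Rightarrow> complex" where
  "q_shift q g x = g (q * x)"

definition q_shift_inv :: "complex \<Rightarrow> (complex \<Rightarrow> complex) \<Rightarrow> complex \<Rightarrow> complex" where
  "q_shift_inv q g x = g (x / q)"

definition A4 ::
  "complex \<Rightarrow> complex \<Rightarrow> complex \<Rightarrow> complex \<Rightarrow>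
   complex \<Rightarrow> complex \<Rightarrow> complex \<Rightarrow> complex \<Rightarrow> complex \<Rightarrow> complex \<Rightarrow> complex \<Rightarrow>
   (complex \<Rightarrow> complex) \<Rightarrow> complex \<Rightarrow> complex" where
  "A4 q L t\<^sub>1 t\<^sub>2 h\<^sub>1 h\<^sub>2 l\<^sub>1 l\<^sub>2 \<alpha>\<^sub>1 \<alpha>\<^sub>2 \<beta> g x =
     inverse x * (x - q_power L (h\<^sub>1 + 1/2) * t\<^sub>1) * (x - q_power L (h\<^sub>2 + 1/2) * t\<^sub>2)
       * q_shift_inv q g x
   + q_power L (\<alpha>\<^sub>1 + \<alpha>\<^sub>2) * inverse x
       * (x - q_power L (l\<^sub>1 - 1/2) * t\<^sub>1) * (x - q_power L (l\<^sub>2 - 1/2) * t\<^sub>2)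
       * q_shift q g x
   - ((q_power L \<alpha>\<^sub>1 + q_power L \<alpha>\<^sub>2) * x
       + q_power L ((h\<^sub>1 + h\<^sub>2 + l\<^sub>1 + l\<^sub>2 + \<alpha>\<^sub>1 + \<alpha>\<^sub>2) / 2)
         * (q_power L (\<beta> / 2) + q_power L (- \<beta> / 2)) * t\<^sub>1 * t\<^sub>2 * inverse x)
       * g x"

text \<open>
  The system of \<open>q\<close>-difference equations for the kernel function.
  \<open>D\<close> is the set of points at which \<open>P\<close> is defined (nontrivial solutions are in general
  only meromorphic). Each single equality is required exactly where both of its sides are defined:
  the values of \<open>P\<close> involved are at points of \<open>D\<close>, and the denominator does not vanish.
\<close>

definition kernel_equations ::
  "complex \<Rightarrow> complex \<Rightarrow> complex \<Rightarrow> complex \<Rightarrow> (complex \<times> complex) set \<Rightarrow>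
   (complex \<Rightarrow> complex \<Rightarrow> complex) \<Rightarrow> bool" where
  "kernel_equations q L \<mu> \<mu>\<^sub>0 D P \<longleftrightarrow>
     (\<forall>x s. (x, s / q) \<in> D \<and> (q * x, s) \<in> D \<longrightarrow> P x (s / q) = P (q * x) s) \<and>
     (\<forall>x s. (q * x, s) \<in> D \<and> (x, s) \<in> D \<and> x - q_power L (\<mu>\<^sub>0 - 1) * s \<noteq> 0 \<longrightarrow>
        P (q * x) s = (x - q_power L (\<mu> - 1) * s) / (x - q_power L (\<mu>\<^sub>0 - 1) * s) * P x s) \<and>
     (\<forall>x s. (x, q * s) \<in> D \<and> (x / q, s) \<in> D \<longrightarrow> P x (q * s) = P (x / q) s) \<and>
     (\<forall>x s. (x / q, s) \<in> D \<and> (x, s) \<in> D \<and> x - q_power L \<mu> * s \<noteq> 0 \<longrightarrow>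
        P (x / q) s = (x - q_power L \<mu>\<^sub>0 * s) / (x - q_power L \<mu> * s) * P x s)"

end

theory Submission
  imports Defs
begin

text \<open>
  After division by the power functions, both sides of the identity are linear combinations of
  \<open>P(x/q, s) = P(x, qs)\<close>, \<open>P(qx, s) = P(x, s/q)\<close> and \<open>P(x, s)\<close>. The parameter
  relations say that the two coefficient polynomials on the left are the rescalings of those on
  the right: with \<open>M = q^\<mu>\<close>, the roots \<open>q^(h_i + 1/2) t_i\<close> in \<open>x\<close> are \<open>M\<close> times the roots
  \<open>q^(l_i' - 1/2) t_i\<close> in \<open>s\<close>, and likewise for the other shift with \<open>N = q^(\<mu>\<^sub>0 - 1)\<close>.
  The exponents \<open>-\<alpha>\<^sub>1\<close> and \<open>1 + chi - \<alpha>\<^sub>1'\<close> of the power functions, together with \<open>\<nu>\<close>, make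
  the constant factors in front agree up to \<open>M\<close> and \<open>N\<close>.
  Therefore the difference of the coefficients of \<open>P(x/q, s)\<close> vanishes for \<open>x = M s\<close> and that of
  \<open>P(qx, s)\<close> vanishes for \<open>x = N s\<close> (lemma \<open>scaled_quadratic_difference\<close>). These two factors
  are exactly the denominators in the equations for \<open>P\<close>, so that they turn the shifted values of
  \<open>P\<close> into multiples of \<open>P(x, s)\<close>. What remains is to compare the factors of \<open>P(x, s)\<close>, which
  are combinations of \<open>x\<close>, \<open>s\<close>, \<open>1/x\<close> and \<open>1/s\<close>: \<open>\<alpha>\<^sub>2\<close> and \<open>\<nu>\<close> match the coefficients of \<open>s\<close>,
  and \<open>chi\<close> and \<open>\<beta>\<close> those of \<open>1/x\<close> and \<open>1/s\<close>.

  The denominators may vanish at the given point. As only the cross-multiplied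
  equations enter, it suffices that these hold there as well
  (lemmas \<open>kernel_shift_cross_mult\<close> and \<open>kernel_shift_inv_cross_mult\<close>).
\<close>

section \<open>The kernel equations without denominators\<close>

lemma q_power_add: "q_power L (a + b) = q_power L a * q_power L b"
  by (simp add: q_power_def distrib_right exp_add)

lemma q_power_diff_1:
  assumes "exp L = q"
  shows "q_power L (a - 1) = q_power L a / q"
  using assms by (simp add: q_power_def left_diff_distrib exp_diff)

text \<open>
  If \<open>x = q^(\<mu>\<^sub>0 - 1) s\<close>, then the equation for \<open>P(qx, s)\<close> is not available, but the one for the
  inverse shift, taken at \<open>qx\<close>, has a vanishing numerator and gives \<open>P(x, s) = 0\<close>; its own
  denominator vanishes only if \<open>q^\<mu> s = q^\<mu>\<^sub>0 s\<close>, and then both sides below are zero.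
\<close>

lemma kernel_shift_cross_mult:
  assumes ker: "kernel_equations q L \<mu> \<mu>\<^sub>0 D P" and q: "exp L = q"
    and D: "(q * x, s) \<in> D" "(x, s) \<in> D"
  shows "(x - q_power L (\<mu>\<^sub>0 - 1) * s) * P (q * x) s = (x - q_power L (\<mu> - 1) * s) * P x s"
proof (cases "x - q_power L (\<mu>\<^sub>0 - 1) * s = 0")
  case False
  then have "P (q * x) s = (x - q_power L (\<mu> - 1) * s) / (x - q_power L (\<mu>\<^sub>0 - 1) * s) * P x s"
    using ker D unfolding kernel_equations_def by blast
  with False show ?thesis by simp
next
  case zero: True
  have q0: "q \<noteq> 0" using q exp_not_eq_zero by blast
  have inv_eq: "P (q * x / q) s
      = (q * x - q_power L \<mu>\<^sub>0 * s) / (q * x - q_power L \<mu> * s) * P (q * x) s"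
    if "q * x - q_power L \<mu> * s \<noteq> 0"
  proof -
    have "(q * x / q, s) \<in> D" using D q0 by simp
    with ker D that show ?thesis unfolding kernel_equations_def by blast
  qed
  have num: "q * x - q_power L \<mu>\<^sub>0 * s = 0"
    using zero q0 by (simp add: q_power_diff_1[OF q] field_simps)
  have "(x - q_power L (\<mu> - 1) * s) * P x s = 0"
  proof (cases "q * x - q_power L \<mu> * s = 0")
    case True
    then show ?thesis using q0 by (simp add: q_power_diff_1[OF q] field_simps)
  next
    case False
    with inv_eq num q0 show ?thesis by simp
  qed
  with zero show ?thesis by simp
qed

lemma kernel_shift_inv_cross_mult:
  assumes ker: "kernel_equations q L \<mu> \<mu>\<^sub>0 D P" and q: "exp L = q"
    and D: "(x / q, s) \<in> D" "(x, s) \<in> D"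
  shows "(x - q_power L \<mu> * s) * P (x / q) s = (x - q_power L \<mu>\<^sub>0 * s) * P x s"
proof (cases "x - q_power L \<mu> * s = 0")
  case False
  then have "P (x / q) s = (x - q_power L \<mu>\<^sub>0 * s) / (x - q_power L \<mu> * s) * P x s"
    using ker D unfolding kernel_equations_def by blast
  with False show ?thesis by simp
next
  case zero: True
  \<comment> \<open>The equation for the shift, taken at \<open>x / q\<close>, now forces \<open>P(x, s) = 0\<close> unless
    \<open>q^\<mu> s = q^\<mu>\<^sub>0 s\<close>.\<close>
  have q0: "q \<noteq> 0" using q exp_not_eq_zero by blast
  have shift_eq: "P (q * (x / q)) s = (x / q - q_power L (\<mu> - 1) * s)
      / (x / q - q_power L (\<mu>\<^sub>0 - 1) * s) * P (x / q) s"
    if "x / q - q_power L (\<mu>\<^sub>0 - 1) * s \<noteq> 0"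
  proof -
    have "(q * (x / q), s) \<in> D" using D q0 by simp
    with ker D that show ?thesis unfolding kernel_equations_def by blast
  qed
  have num: "x / q - q_power L (\<mu> - 1) * s = 0"
    using zero q0 by (simp add: q_power_diff_1[OF q] field_simps)
  have "(x - q_power L \<mu>\<^sub>0 * s) * P x s = 0"
  proof (cases "x / q - q_power L (\<mu>\<^sub>0 - 1) * s = 0")
    case True
    then show ?thesis using q0 by (simp add: q_power_diff_1[OF q] field_simps)
  next
    case False
    with shift_eq num q0 show ?thesis by simp
  qed
  with zero show ?thesis by simp
qed

section \<open>The underlying rational identity\<close>

text \<open>
  Dividing the quadratics by the variable makes their linear terms, \<open>-M (a + b)\<close> on
  both sides, constants that cancel; so the difference factors even though \<open>a\<close> and \<open>b\<close> are
  arbitrary.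
\<close>

lemma scaled_quadratic_difference:
  fixes x s M a b :: "'a::field"
  assumes "x \<noteq> 0" "s \<noteq> 0"
  shows "(x - M * a) * (x - M * b) / x - M * ((s - a) * (s - b) / s)
    = (x - M * s) * (1 - M * (a * b) / (x * s))"
  using assms by (simp add: field_simps)

text \<open>
  The rational identity behind the theorem, freed of exponents: \<open>A\<close>, \<open>B\<close> stand for \<open>q^\<alpha>\<^sub>1\<close>,
  \<open>q^\<alpha>\<^sub>2\<close>, and \<open>M\<close>, \<open>N\<close> for the scalings \<open>q^\<mu>\<close>, \<open>q^(\<mu>\<^sub>0 - 1)\<close> between the roots, while \<open>U = q^\<mu>\<^sub>0\<close> and \<open>V = q^(\<mu> - 1)\<close> come from the numerators in the
  equations for \<open>P\<close>. The values \<open>p\<close>, \<open>pm\<close>, \<open>pp\<close> are those of \<open>P\<close> at \<open>(x, s)\<close>, \<open>(x/q, s)\<close> and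
  \<open>(qx, s)\<close>. The hypotheses on \<open>E\<close>, \<open>K\<close> and \<open>K'\<close> are what comparing the coefficients of \<open>s\<close>,
  \<open>1/x\<close> and \<open>1/s\<close> requires.
\<close>

lemma kernel_identity_scalar:
  fixes x s :: "'a::field"
  assumes "x \<noteq> 0" "s \<noteq> 0"
    and pm: "(x - M * s) * pm = (x - U * s) * p"
    and pp: "(x - N * s) * pp = (x - V * s) * p"
    and E: "E = A * U + B * V"
    and K: "K = A * U * M * (a1 * a2) + B * V * N * (b1 * b2)"
    and K': "K' = A * M * (a1 * a2) + B * N * (b1 * b2)"
  shows "A * ((x - M * a1) * (x - M * a2) / x) * pm
      + B * ((x - N * b1) * (x - N * b2) / x) * pp - ((A + B) * x + K / x) * p
    = A * M * ((s - a1) * (s - a2) / s) * pm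
      + B * N * ((s - b1) * (s - b2) / s) * pp - (E * s + K' / s) * p"
    (is "A * ?Xm * pm + B * ?Xp * pp - ?k * p = A * M * ?Sm * pm + B * N * ?Sp * pp - ?k' * p")
proof -
  have "A * (?Xm - M * ?Sm) * pm = A * (1 - M * (a1 * a2) / (x * s)) * ((x - M * s) * pm)"
    unfolding scaled_quadratic_difference[OF assms(1,2)] by (simp only: ac_simps)
  then have m: "A * (?Xm - M * ?Sm) * pm = A * (1 - M * (a1 * a2) / (x * s)) * (x - U * s) * p"
    unfolding pm by (simp only: ac_simps)
  have "B * (?Xp - N * ?Sp) * pp = B * (1 - N * (b1 * b2) / (x * s)) * ((x - N * s) * pp)"
    unfolding scaled_quadratic_difference[OF assms(1,2)] by (simp only: ac_simps)
  then have p: "B * (?Xp - N * ?Sp) * pp = B * (1 - N * (b1 * b2) / (x * s)) * (x - V * s) * p"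
    unfolding pp by (simp only: ac_simps)
  have expand: "(1 - w / (x * s)) * (x - u * s) = x - u * s - w / s + u * w / x" for u w
    using assms(1,2) by (simp add: field_simps)
  have "A * (1 - M * (a1 * a2) / (x * s)) * (x - U * s)
      + B * (1 - N * (b1 * b2) / (x * s)) * (x - V * s) = ?k - ?k'"
    unfolding E K K' mult.assoc[of A "1 - _"] mult.assoc[of B "1 - _"] expand
    by (simp add: algebra_simps add_divide_distrib)
  then have "A * (?Xm - M * ?Sm) * pm + B * (?Xp - N * ?Sp) * pp = (?k - ?k') * p"
    unfolding m p by (simp flip: distrib_right)
  moreover have "A * u * y + B * v * z - k * w - (A * M * u' * y + B * N * v' * z - k' * w)
      = A * (u - M * u') * y + B * (v - N * v') * z - (k - k') * w" for u v u' v' y z w k k'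
    by (simp add: algebra_simps)
  ultimately show ?thesis
    by (metis (no_types, lifting) right_minus_eq)
qed

section \<open>The kernel function identity\<close>

text \<open>
  Conjugation by the power functions: they only contribute a common factor \<open>c\<close> and, to the two
  shifted values, powers of \<open>q\<close>, which are put into \<open>gm\<close> and \<open>gp\<close>.
\<close>

lemma A4_common_factor:
  assumes g: "g (x / q) = c * gm" "g (q * x) = c * gp" "g x = c * g0"
  shows "A4 q L t\<^sub>1 t\<^sub>2 h\<^sub>1 h\<^sub>2 l\<^sub>1 l\<^sub>2 \<alpha>\<^sub>1 \<alpha>\<^sub>2 \<beta> g x
    = c * ((x - q_power L (h\<^sub>1 + 1/2) * t\<^sub>1) * (x - q_power L (h\<^sub>2 + 1/2) * t\<^sub>2) / x * gm
      + q_power L (\<alpha>\<^sub>1 + \<alpha>\<^sub>2)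
        * ((x - q_power L (l\<^sub>1 - 1/2) * t\<^sub>1) * (x - q_power L (l\<^sub>2 - 1/2) * t\<^sub>2) / x) * gp
      - ((q_power L \<alpha>\<^sub>1 + q_power L \<alpha>\<^sub>2) * x
        + q_power L ((h\<^sub>1 + h\<^sub>2 + l\<^sub>1 + l\<^sub>2 + \<alpha>\<^sub>1 + \<alpha>\<^sub>2) / 2)
          * (q_power L (\<beta> / 2) + q_power L (- \<beta> / 2)) * t\<^sub>1 * t\<^sub>2 / x) * g0)"
proof -
  have "i * u * v * (c * gm) + w * i * u' * v' * (c * gp) - k * (c * g0)
      = c * (u * v * i * gm + w * (u' * v' * i) * gp - k * g0)" for i u v w u' v' k
    by (simp add: algebra_simps)
  then show ?thesis
    unfolding A4_def q_shift_def q_shift_inv_def g divide_inverse[of _ x] .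
qed

theorem theorem2p1:
  fixes q L t\<^sub>1 t\<^sub>2 :: complex
    and h\<^sub>1 h\<^sub>2 l\<^sub>1 l\<^sub>2 \<alpha>\<^sub>1 \<alpha>\<^sub>2 \<beta> :: complex
    and h\<^sub>1' h\<^sub>2' l\<^sub>1' l\<^sub>2' \<alpha>\<^sub>1' \<alpha>\<^sub>2' \<beta>' :: complex
    and \<mu>\<^sub>0 \<mu> chi \<nu> :: complex
    and log\<^sub>x log\<^sub>s :: "complex \<Rightarrow> complex"
    and D :: "(complex \<times> complex) set"
    and P :: "complex \<Rightarrow> complex \<Rightarrow> complex"
    and x s :: complex
  assumes "0 < norm q" and "norm q < 1" and "exp L = q"
    and "q_log_branch q L log\<^sub>x" and "q_log_branch q L log\<^sub>s"
    and "chi = (h\<^sub>1' + h\<^sub>2' - l\<^sub>1' - l\<^sub>2' + \<alpha>\<^sub>1' - \<alpha>\<^sub>2' - \<beta>') / 2"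
    and "\<nu> = \<mu>\<^sub>0 + \<alpha>\<^sub>1 - \<alpha>\<^sub>2'"
    and "\<mu> = \<mu>\<^sub>0 + chi + 1"
    and "\<beta> = - \<beta>' - chi"
    and "\<alpha>\<^sub>2 = \<alpha>\<^sub>1 + \<alpha>\<^sub>1' - \<alpha>\<^sub>2' - chi"
    and "l\<^sub>1 = h\<^sub>1' + \<mu>\<^sub>0" and "l\<^sub>2 = h\<^sub>2' + \<mu>\<^sub>0"
    and "h\<^sub>1 = l\<^sub>1' + \<mu>\<^sub>0 + chi" and "h\<^sub>2 = l\<^sub>2' + \<mu>\<^sub>0 + chi"
    and "kernel_equations q L \<mu> \<mu>\<^sub>0 D P"
    and "x \<noteq> 0" and "s \<noteq> 0"
    and "{(x, s), (q * x, s), (x / q, s), (x, q * s), (x, s / q)} \<subseteq> D"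
  shows "A4 q L t\<^sub>1 t\<^sub>2 h\<^sub>1 h\<^sub>2 l\<^sub>1 l\<^sub>2 \<alpha>\<^sub>1 \<alpha>\<^sub>2 \<beta>
           (\<lambda>y. branch_power log\<^sub>x y (- \<alpha>\<^sub>1) * branch_power log\<^sub>s s (1 + chi - \<alpha>\<^sub>1') * P y s) x
       = q_power L \<nu> *
         A4 q L t\<^sub>1 t\<^sub>2 h\<^sub>1' h\<^sub>2' l\<^sub>1' l\<^sub>2' \<alpha>\<^sub>1' \<alpha>\<^sub>2' \<beta>'
           (\<lambda>r. branch_power log\<^sub>x x (- \<alpha>\<^sub>1) * branch_power log\<^sub>s r (1 + chi - \<alpha>\<^sub>1') * P x r) s"
proof -
  note chi = assms(6) and nu = assms(7) and mu = assms(8) and beta = assms(9)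
    and alpha2 = assms(10) and params = assms(11-14)
  note ker = assms(15) and x0 = assms(16) and s0 = assms(17) and D = assms(18)
  have q0: "q \<noteq> 0" using assms(1) by auto
  define Q where "Q = q_power L"
  have Q_add: "Q a * Q b = Q (a + b)" for a b
    by (simp add: Q_def q_power_add)
  define M N where "M = Q \<mu>" and "N = Q (\<mu>\<^sub>0 - 1)"
  define a1 a2 where "a1 = Q (l\<^sub>1' - 1/2) * t\<^sub>1" and "a2 = Q (l\<^sub>2' - 1/2) * t\<^sub>2"
  define b1 b2 where "b1 = Q (h\<^sub>1' + 1/2) * t\<^sub>1" and "b2 = Q (h\<^sub>2' + 1/2) * t\<^sub>2"
  define c where "c = branch_power log\<^sub>x x (- \<alpha>\<^sub>1) * branch_power log\<^sub>s s (1 + chi - \<alpha>\<^sub>1')"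
  define p pm pp where "p = P x s" and "pm = P (x / q) s" and "pp = P (q * x) s"
  define E K K' where "E = Q \<nu> * (Q \<alpha>\<^sub>1' + Q \<alpha>\<^sub>2')"
    and "K = Q ((h\<^sub>1 + h\<^sub>2 + l\<^sub>1 + l\<^sub>2 + \<alpha>\<^sub>1 + \<alpha>\<^sub>2) / 2) * (Q (\<beta> / 2) + Q (- \<beta> / 2)) * t\<^sub>1 * t\<^sub>2"
    and "K' = Q \<nu> * (Q ((h\<^sub>1' + h\<^sub>2' + l\<^sub>1' + l\<^sub>2' + \<alpha>\<^sub>1' + \<alpha>\<^sub>2') / 2)
      * (Q (\<beta>' / 2) + Q (- \<beta>' / 2)) * t\<^sub>1 * t\<^sub>2)"
  note Q_regroup = Q_add mult.assoc[symmetric]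

  have shift_m: "P x (q * s) = pm" and shift_p: "P x (s / q) = pp"
    using ker D unfolding kernel_equations_def pm_def pp_def by blast+
  have eq_m: "(x - M * s) * pm = (x - Q \<mu>\<^sub>0 * s) * p"
    using kernel_shift_inv_cross_mult[OF ker assms(3)] D by (simp add: pm_def p_def M_def Q_def)
  have eq_p: "(x - N * s) * pp = (x - Q (\<mu> - 1) * s) * p"
    using kernel_shift_cross_mult[OF ker assms(3)] D by (simp add: pp_def p_def N_def Q_def)

  have roots: "Q (h\<^sub>1 + 1/2) * t\<^sub>1 = M * a1" "Q (h\<^sub>2 + 1/2) * t\<^sub>2 = M * a2"
    "Q (l\<^sub>1 - 1/2) * t\<^sub>1 = N * b1" "Q (l\<^sub>2 - 1/2) * t\<^sub>2 = N * b2"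
    unfolding M_def N_def a1_def a2_def b1_def b2_def
    by (simp_all add: Q_regroup params mu algebra_simps)

  have E: "E = Q \<alpha>\<^sub>1 * Q \<mu>\<^sub>0 + Q \<alpha>\<^sub>2 * Q (\<mu> - 1)"
    unfolding E_def by (simp add: distrib_left Q_add nu mu alpha2 algebra_simps)

  \<comment> \<open>On both sides the two powers of \<open>q\<close> come from the two signs of \<open>\<beta>/2\<close> (respectively
    \<open>\<beta>'/2\<close>). Since \<open>\<beta> = -\<beta>' - chi\<close>, a sign on one side corresponds to the opposite sign on
    the other.\<close>
  have K: "K = Q \<alpha>\<^sub>1 * Q \<mu>\<^sub>0 * M * (a1 * a2) + Q \<alpha>\<^sub>2 * Q (\<mu> - 1) * N * (b1 * b2)"
  proof -
    have "Q \<alpha>\<^sub>1 * Q \<mu>\<^sub>0 * M * (a1 * a2)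
        = (Q \<alpha>\<^sub>1 * Q \<mu>\<^sub>0 * Q \<mu> * Q (l\<^sub>1' - 1/2) * Q (l\<^sub>2' - 1/2)) * t\<^sub>1 * t\<^sub>2"
      unfolding M_def a1_def a2_def by (simp only: ac_simps)
    also have "\<dots> = Q ((h\<^sub>1 + h\<^sub>2 + l\<^sub>1 + l\<^sub>2 + \<alpha>\<^sub>1 + \<alpha>\<^sub>2) / 2) * Q (\<beta> / 2) * t\<^sub>1 * t\<^sub>2"
      unfolding Q_add params beta alpha2 mu chi
      by (intro arg_cong2[where f = "(*)"] arg_cong[where f = Q] refl) (simp add: field_simps)
    finally have A: "Q \<alpha>\<^sub>1 * Q \<mu>\<^sub>0 * M * (a1 * a2)
        = Q ((h\<^sub>1 + h\<^sub>2 + l\<^sub>1 + l\<^sub>2 + \<alpha>\<^sub>1 + \<alpha>\<^sub>2) / 2) * Q (\<beta> / 2) * t\<^sub>1 * t\<^sub>2" .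
    have "Q \<alpha>\<^sub>2 * Q (\<mu> - 1) * N * (b1 * b2)
        = (Q \<alpha>\<^sub>2 * Q (\<mu> - 1) * Q (\<mu>\<^sub>0 - 1) * Q (h\<^sub>1' + 1/2) * Q (h\<^sub>2' + 1/2)) * t\<^sub>1 * t\<^sub>2"
      unfolding N_def b1_def b2_def by (simp only: ac_simps)
    also have "\<dots> = Q ((h\<^sub>1 + h\<^sub>2 + l\<^sub>1 + l\<^sub>2 + \<alpha>\<^sub>1 + \<alpha>\<^sub>2) / 2) * Q (- \<beta> / 2) * t\<^sub>1 * t\<^sub>2"
      unfolding Q_add params beta alpha2 mu chi
      by (intro arg_cong2[where f = "(*)"] arg_cong[where f = Q] refl) (simp add: field_simps)
    finally show ?thesis
      unfolding A K_def by (simp only: distrib_left distrib_right add.commute)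
  qed
  have K': "K' = Q \<alpha>\<^sub>1 * M * (a1 * a2) + Q \<alpha>\<^sub>2 * N * (b1 * b2)"
  proof -
    have "Q \<alpha>\<^sub>1 * M * (a1 * a2)
        = (Q \<alpha>\<^sub>1 * Q \<mu> * Q (l\<^sub>1' - 1/2) * Q (l\<^sub>2' - 1/2)) * t\<^sub>1 * t\<^sub>2"
      unfolding M_def a1_def a2_def by (simp only: ac_simps)
    also have "\<dots> = Q \<nu> * Q ((h\<^sub>1' + h\<^sub>2' + l\<^sub>1' + l\<^sub>2' + \<alpha>\<^sub>1' + \<alpha>\<^sub>2') / 2) * Q (- \<beta>' / 2) * t\<^sub>1 * t\<^sub>2"
      unfolding Q_add nu mu chi
      by (intro arg_cong2[where f = "(*)"] arg_cong[where f = Q] refl) (simp add: field_simps)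
    finally have A: "Q \<alpha>\<^sub>1 * M * (a1 * a2)
        = Q \<nu> * Q ((h\<^sub>1' + h\<^sub>2' + l\<^sub>1' + l\<^sub>2' + \<alpha>\<^sub>1' + \<alpha>\<^sub>2') / 2) * Q (- \<beta>' / 2) * t\<^sub>1 * t\<^sub>2" .
    have "Q \<alpha>\<^sub>2 * N * (b1 * b2)
        = (Q \<alpha>\<^sub>2 * Q (\<mu>\<^sub>0 - 1) * Q (h\<^sub>1' + 1/2) * Q (h\<^sub>2' + 1/2)) * t\<^sub>1 * t\<^sub>2"
      unfolding N_def b1_def b2_def by (simp only: ac_simps)
    also have "\<dots> = Q \<nu> * Q ((h\<^sub>1' + h\<^sub>2' + l\<^sub>1' + l\<^sub>2' + \<alpha>\<^sub>1' + \<alpha>\<^sub>2') / 2) * Q (\<beta>' / 2) * t\<^sub>1 * t\<^sub>2"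
      unfolding Q_add nu alpha2 chi
      by (intro arg_cong2[where f = "(*)"] arg_cong[where f = Q] refl) (simp add: field_simps)
    finally show ?thesis
      unfolding A K'_def by (simp only: distrib_left distrib_right mult.assoc add.commute)
  qed

  \<comment> \<open>The powers of \<open>q\<close> that the shifts draw from \<open>x^(-\<alpha>\<^sub>1)\<close> and \<open>s^(1 + chi - \<alpha>\<^sub>1')\<close> give both
    sides the factors \<open>q^\<alpha>\<^sub>1\<close> and \<open>q^\<alpha>\<^sub>2\<close>, times \<open>M\<close> and \<open>N\<close> in \<open>s\<close>.\<close>
  have alpha_canc: "Q (\<alpha>\<^sub>1 + \<alpha>\<^sub>2) * Q (- \<alpha>\<^sub>1) = Q \<alpha>\<^sub>2"
    by (simp add: Q_add)
  have s_up: "Q \<nu> * Q (\<alpha>\<^sub>1' + \<alpha>\<^sub>2') * Q (1 + chi - \<alpha>\<^sub>1') = Q \<alpha>\<^sub>1 * M"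
    unfolding M_def by (simp add: Q_add nu mu algebra_simps)
  have s_down: "Q \<nu> * Q (- (1 + chi - \<alpha>\<^sub>1')) = Q \<alpha>\<^sub>2 * N"
    unfolding N_def by (simp add: Q_add nu alpha2 algebra_simps)

  have lhs: "A4 q L t\<^sub>1 t\<^sub>2 h\<^sub>1 h\<^sub>2 l\<^sub>1 l\<^sub>2 \<alpha>\<^sub>1 \<alpha>\<^sub>2 \<beta>
      (\<lambda>y. branch_power log\<^sub>x y (- \<alpha>\<^sub>1) * branch_power log\<^sub>s s (1 + chi - \<alpha>\<^sub>1') * P y s) x
    = c * (Q \<alpha>\<^sub>1 * ((x - M * a1) * (x - M * a2) / x) * pm
      + Q \<alpha>\<^sub>2 * ((x - N * b1) * (x - N * b2) / x) * pp
      - ((Q \<alpha>\<^sub>1 + Q \<alpha>\<^sub>2) * x + K / x) * p)" (is "A4 _ _ _ _ _ _ _ _ _ _ _ ?g x = _")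
  proof -
    have g: "?g (x / q) = c * (Q \<alpha>\<^sub>1 * pm)" "?g (q * x) = c * (Q (- \<alpha>\<^sub>1) * pp)" "?g x = c * p"
      unfolding branch_power_shift[OF assms(4) q0 x0] c_def p_def pm_def pp_def Q_def
      by (simp_all add: mult_ac)
    show ?thesis
      unfolding A4_common_factor[where g = ?g, OF g] Q_def[symmetric] roots K_def
        alpha_canc[symmetric]
      by (simp only: mult_ac times_divide_eq_left times_divide_eq_right)
  qed

  have rhs: "Q \<nu> * A4 q L t\<^sub>1 t\<^sub>2 h\<^sub>1' h\<^sub>2' l\<^sub>1' l\<^sub>2' \<alpha>\<^sub>1' \<alpha>\<^sub>2' \<beta>'
      (\<lambda>r. branch_power log\<^sub>x x (- \<alpha>\<^sub>1) * branch_power log\<^sub>s r (1 + chi - \<alpha>\<^sub>1') * P x r) s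
    = c * (Q \<alpha>\<^sub>1 * M * ((s - a1) * (s - a2) / s) * pm
      + Q \<alpha>\<^sub>2 * N * ((s - b1) * (s - b2) / s) * pp - (E * s + K' / s) * p)"
    (is "_ * A4 _ _ _ _ _ _ _ _ _ _ _ ?g s = _")
  proof -
    have g: "?g (s / q) = c * (Q (- (1 + chi - \<alpha>\<^sub>1')) * pp)"
      "?g (q * s) = c * (Q (1 + chi - \<alpha>\<^sub>1') * pm)" "?g s = c * p"
      unfolding branch_power_shift[OF assms(5) q0 s0] shift_m shift_p c_def p_def Q_def
      by (simp_all add: mult_ac)
    have collect: "n * (c * (u * (k * y) + w * v * (k' * y') - (e * s + f / s) * p))
        = c * (n * w * k' * v * y' + n * k * u * y - (n * e * s + n * f / s) * p)"
      for n u k y w v k' y' e f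
      by (simp add: algebra_simps)
    show ?thesis
      unfolding A4_common_factor[where g = ?g, OF g] Q_def[symmetric] a1_def[symmetric]
        a2_def[symmetric] b1_def[symmetric] b2_def[symmetric] collect s_up s_down E_def K'_def
      by (rule refl)
  qed

  show ?thesis
    unfolding lhs kernel_identity_scalar[OF x0 s0 eq_m eq_p E K K'] rhs[symmetric]
    by (simp only: Q_def)
qed

end
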